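(* Let $D$ be a (connected) diagram of an oriented link $K\subset S^3$, and let $w(D)$ denote its writhe. Also let $G$ be a Tait graph of $D$, with $V$, $E_+$, and $E_-$ respectively denoting the numbers of vertices, positive edges, and negative edges in $G$. Then, for any integer $n\geq 3$, writing \[x=\sqrt{2}\left(\sqrt{n}(3-n)+(n-1)\sqrt{n-4}\right)^{-1/2},\] \[y=\frac{x}{2}\left(2-n+\sqrt{n(n-4)}\right),\] and \[t=\frac{y}{x}=\frac{1}{2}\left(2-n+\sqrt{n(n-4)}\right),\] and using as Boltzmann weights either \[b_+^{=}=x,\quad b_-^{=}=x^{-1},\quad b_+^{\neq}=y,\quad b_-^{\neq}=y^{-1},\] or \[B_+^{=}=1=B_-^{=},\quad B_+^{\neq}=t^{-1},\quad B_-^{\neq}=t,\] the $n$-th Potts invariant $\mathrm{Potts}_n(K)$ of $K$ is given by either of the following equivalent formulas: \[\mathrm{Potts}_n(K)=\left(\frac{1}{\sqrt{n}}\right)^{V+1}x^{w(D)+E_--E_+}\sum_{\text{states}}\ \prod_{\text{edges }e}B(e),\] \[\mathrm{Potts}_n(K)=\left(\frac{1}{\sqrt{n}}\right)^{V+1}x^{-w(D)}\sum_{\text{states}}\ \prod_{\text{edges }e}b(e).\]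
   Context: **Tait graph.** Let $D\subset S^2$ be a connected link diagram (all diagrams are assumed connected). Color the regions of $S^2\setminus D$ black and white in checkerboard fashion (either of the two colorings). The Tait graph $G$ has one vertex per black region and, for each crossing, one edge joining the (possibly equal) black regions incident there. The edge is positive if the two black regions at the crossing are those swept out when the overstrand is rotated counterclockwise about the crossing until it reaches the understrand; otherwise it is negative. The writhe $w(D)$ is the number of positive crossings minus the number of negative crossings. **Spin models.** A spin model is a finite set $\theta$ with $|\theta|=n$ and functions $b_+,b_-:\theta\times\theta\to\mathbb C$ such that for all $a,r,c\in\theta$: $b_\pm(a,c)=b_\pm(c,a)$; $b_+(a,c)b_-(a,c)=1$; $\sum_{z\in\theta}b_-(a,z)b_+(z,c)=n\,\delta(a,c)$; and $\sum_{z\in\theta}b_+(a,z)b_+(r,z)b_-(c,z)=\sqrt n\,b_+(a,r)b_-(r,c)b_-(c,a)$. It is a Potts model if $n\ge 3$ and $b_\pm(a,c)$ equals a constant $b_\pm^{=}$ when $a=c$ and a constant $b_\pm^{\neq}$ when $a\ne c$. **States and weights.** A state is a function $\sigma$ from the vertices of $G$ to $\theta$. In a given state, an edge $e$ with endpoints $u,v$ and sign $\pm$ has weight $b(e)=b_\pm^{=}$ if $\sigma(u)=\sigma(v)$ and $b(e)=b_\pm^{\neq}$ otherwise; $B(e)$ is defined the same way from the numbers $B_\pm^{=},B_\pm^{\neq}$. **Potts invariant.** For a Potts model with weights $b$, the partition function of $D$ is $Z_D=(1/\sqrt n)^{V+1}\sum_{\text{states}}\prod_{\text{edges }e}b(e)$.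 By a theorem of Jones, $(b_-^{=})^{w(D)}Z_D$ is an invariant of the oriented link $K$ represented by $D$. For the Potts model with $|\theta|=n$ this invariant is called the $n$-th Potts invariant of $K$ and denoted $\mathrm{Potts}_n(K)$. Square roots are read as principal values.
   Formalization: The two displayed formulas differ in general (positive Hopf link, n=5). The b formula is proved for the Potts model b, the B formula for b with b_+ and b_- exchanged; each model also gets its partner formula (for b: exponent -w(D)+E_+-E_-, with B_+ and B_- exchanged). *)

theory Defs
  imports "HOL-Analysis.Analysis"
begin

section \<open>Oriented links in the three-sphere\<close>

type_synonym r4 = "(complex \<times> real) \<times> real"

abbreviation S3 :: "r4 set" where
  "S3 \<equiv> sphere 0 1"

text \<open>Components are indexed by numbers below the number of components; each is a parametrised
  closed curve of period one, and the direction of the parametrisation is the orientation.\<close>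

record link =
  link_comps :: nat
  link_curve :: "nat \<Rightarrow> real \<Rightarrow> r4"

definition closed_C1 :: "(real \<Rightarrow> 'v::real_normed_vector) \<Rightarrow> bool" where
  "closed_C1 f \<longleftrightarrow> f C1_differentiable_on UNIV \<and> (\<forall>s. f (s + 1) = f s)"

definition regular_closed_curve :: "(real \<Rightarrow> 'v::real_normed_vector) \<Rightarrow> bool" where
  "regular_closed_curve f \<longleftrightarrow> closed_C1 f \<and> (\<forall>s. vector_derivative f (at s) \<noteq> 0)"

definition oriented_link :: "link \<Rightarrow> bool" where
  "oriented_link K \<longleftrightarrow> link_comps K \<ge> 1 \<and>
     (\<forall>i < link_comps K. regular_closed_curve (link_curve K i) \<and> range (link_curve K i) \<subseteq> S3) \<and>
     inj_on (\<lambda>(i, s). link_curve K i s) ({..<link_comps K} \<times> {0..<1})"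

section \<open>Link diagrams\<close>

text \<open>A diagram is given in the complex plane, that is, in \<open>S\<^sup>2\<close> minus a point not on the diagram.
  Removing that point from the region that contains it leaves the region connected, so the regions
  correspond to those in \<open>S\<^sup>2\<close>. The height function records which strand is the overstrand; the
  viewer looks down from large heights on the plane with its usual orientation.\<close>

record diagram =
  comps :: nat
  plane :: "nat \<Rightarrow> real \<Rightarrow> complex"
  height :: "nat \<Rightarrow> real \<Rightarrow> real"

type_synonym strand_point = "nat \<times> real"

definition strand_points :: "diagram \<Rightarrow> strand_point set" where
  "strand_points D = {..<comps D} \<times> {0..<1}"

definition pos :: "diagram \<Rightarrow> strand_point \<Rightarrow> complex" where
  "pos D a = plane D (fst a) (snd a)"

definition alt :: "diagram \<Rightarrow> strand_point \<Rightarrow> real" where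
  "alt D a = height D (fst a) (snd a)"

definition tangent :: "diagram \<Rightarrow> strand_point \<Rightarrow> complex" where
  "tangent D a = vector_derivative (plane D (fst a)) (at (snd a))"

definition trace :: "diagram \<Rightarrow> complex set" where
  "trace D = pos D ` strand_points D"

text \<open>A crossing is the pair of its overstrand point and its understrand point.\<close>

definition crossings :: "diagram \<Rightarrow> (strand_point \<times> strand_point) set" where
  "crossings D = {(a, b). a \<in> strand_points D \<and> b \<in> strand_points D \<and> a \<noteq> b \<and>
                          pos D a = pos D b \<and> alt D a > alt D b}"

text \<open>Positive iff the direction of \<open>w\<close> is obtained from that of \<open>v\<close> by a counterclockwise rotation
  through an angle in \<open>(0, \<pi>)\<close>.\<close>

definition det2 :: "complex \<Rightarrow> complex \<Rightarrow> real" where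
  "det2 v w = Im (cnj v * w)"

definition link_diagram :: "diagram \<Rightarrow> bool" where
  "link_diagram D \<longleftrightarrow> comps D \<ge> 1 \<and>
     (\<forall>i < comps D. regular_closed_curve (plane D i) \<and> closed_C1 (height D i)) \<and>
     (\<forall>p. card {a \<in> strand_points D. pos D a = p} \<le> 2 \<and>
          finite {a \<in> strand_points D. pos D a = p}) \<and>
     (\<forall>a \<in> strand_points D. \<forall>b \<in> strand_points D. a \<noteq> b \<and> pos D a = pos D b \<longrightarrow>
          alt D a \<noteq> alt D b \<and> det2 (tangent D a) (tangent D b) \<noteq> 0) \<and>
     finite (crossings D)"

definition connected_diagram :: "diagram \<Rightarrow> bool" where
  "connected_diagram D \<longleftrightarrow> link_diagram D \<and> connected (trace D)"

definition positive_crossing :: "diagram \<Rightarrow> strand_point \<times> strand_point \<Rightarrow> bool" where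
  "positive_crossing D e \<longleftrightarrow> det2 (tangent D (fst e)) (tangent D (snd e)) > 0"

definition writhe :: "diagram \<Rightarrow> int" where
  "writhe D = int (card {e \<in> crossings D. positive_crossing D e})
            - int (card {e \<in> crossings D. \<not> positive_crossing D e})"

subsection \<open>Diagrams of a link\<close>

text \<open>Inverse stereographic projection; it also fixes the orientation of \<open>S\<^sup>3\<close>.\<close>

definition to_S3 :: "complex \<times> real \<Rightarrow> r4" where
  "to_S3 p = ((2 / (norm p ^ 2 + 1)) *\<^sub>R p, (norm p ^ 2 - 1) / (norm p ^ 2 + 1))"

definition ambient_isotopy :: "(real \<Rightarrow> r4 \<Rightarrow> r4) \<Rightarrow> bool" where
  "ambient_isotopy H \<longleftrightarrow> continuous_on ({0..1} \<times> S3) (\<lambda>(u, p). H u p) \<and>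
     (\<forall>u \<in> {0..1}. \<exists>g. homeomorphism S3 S3 (H u) g) \<and> (\<forall>p \<in> S3. H 0 p = p)"

text \<open>The lift of an orientation-preserving homeomorphism of the circle.\<close>

definition reparametrisation :: "(real \<Rightarrow> real) \<Rightarrow> bool" where
  "reparametrisation \<rho> \<longleftrightarrow> continuous_on UNIV \<rho> \<and> strict_mono \<rho> \<and> (\<forall>s. \<rho> (s + 1) = \<rho> s + 1)"

definition diagram_of :: "diagram \<Rightarrow> link \<Rightarrow> bool" where
  "diagram_of D K \<longleftrightarrow> connected_diagram D \<and> oriented_link K \<and>
     (\<exists>H \<pi> \<rho>. ambient_isotopy H \<and> bij_betw \<pi> {..<comps D} {..<link_comps K} \<and>
        (\<forall>i < comps D. reparametrisation (\<rho> i) \<and>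
           (\<forall>s. H 1 (to_S3 (plane D i s, height D i s)) = link_curve K (\<pi> i) (\<rho> i s))))"

section \<open>Tait graphs\<close>

definition regions :: "diagram \<Rightarrow> complex set set" where
  "regions D = components (- trace D)"

text \<open>The region \<open>r\<close> contains the points close to \<open>p\<close> in direction \<open>d\<close>.\<close>

definition occupies :: "complex set \<Rightarrow> complex \<Rightarrow> complex \<Rightarrow> bool" where
  "occupies r p d \<longleftrightarrow> (\<forall>\<^sub>F \<epsilon> in at_right 0. p + of_real \<epsilon> * d \<in> r)"

text \<open>A checkerboard colouring is given by its set of black regions: at each point of the diagram
  that is not a crossing, exactly one of the two sides is black.\<close>

definition checkerboard :: "diagram \<Rightarrow> complex set set \<Rightarrow> bool" where
  "checkerboard D C \<longleftrightarrow> C \<subseteq> regions D \<and>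
     (\<forall>a \<in> strand_points D. (\<forall>b \<in> strand_points D. pos D b = pos D a \<longrightarrow> b = a) \<longrightarrow>
        (\<forall>r \<in> regions D. \<forall>r' \<in> regions D.
           occupies r (pos D a) (\<i> * tangent D a) \<and> occupies r' (pos D a) (- \<i> * tangent D a) \<longrightarrow>
           (r \<in> C) \<noteq> (r' \<in> C)))"

record ('v, 'e) signed_graph =
  verts :: "'v set"
  edges :: "'e set"
  ends :: "'e \<Rightarrow> 'v set"
  positive :: "'e \<Rightarrow> bool"

text \<open>Let \<open>v\<close> and \<open>w\<close> be the tangents of the overstrand and of the understrand. The line through
  \<open>v\<close>, rotated counterclockwise, first reaches the line through \<open>w\<close> at \<open>w' = \<plusminus>w\<close>, with the sign for
  which \<open>det2 v w' > 0\<close>. It sweeps the sector between \<open>v\<close> and \<open>w'\<close>, represented by the direction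
  \<open>v + w'\<close>, and the opposite sector.\<close>

definition swept_direction :: "diagram \<Rightarrow> strand_point \<times> strand_point \<Rightarrow> complex" where
  "swept_direction D e =
     tangent D (fst e) + (if positive_crossing D e then 1 else - 1) * tangent D (snd e)"

definition swept_regions :: "diagram \<Rightarrow> strand_point \<times> strand_point \<Rightarrow> complex set set" where
  "swept_regions D e = {r \<in> regions D. occupies r (pos D (fst e)) (swept_direction D e) \<or>
                                       occupies r (pos D (fst e)) (- swept_direction D e)}"

definition black_regions_at ::
    "diagram \<Rightarrow> complex set set \<Rightarrow> strand_point \<times> strand_point \<Rightarrow> complex set set" where
  "black_regions_at D C e = {r \<in> C. pos D (fst e) \<in> closure r}"

definition tait_graph ::
    "diagram \<Rightarrow> complex set set \<Rightarrow> (complex set, strand_point \<times> strand_point) signed_graph" where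
  "tait_graph D C = \<lparr> verts = C, edges = crossings D, ends = black_regions_at D C,
     positive = (\<lambda>e. black_regions_at D C e = swept_regions D e) \<rparr>"

definition num_pos :: "('v, 'e) signed_graph \<Rightarrow> nat" where
  "num_pos G = card {e \<in> edges G. positive G e}"

definition num_neg :: "('v, 'e) signed_graph \<Rightarrow> nat" where
  "num_neg G = card {e \<in> edges G. \<not> positive G e}"

section \<open>Spin models and Potts invariants\<close>

definition spin_model :: "'s set \<Rightarrow> ('s \<Rightarrow> 's \<Rightarrow> complex) \<Rightarrow> ('s \<Rightarrow> 's \<Rightarrow> complex) \<Rightarrow> bool" where
  "spin_model \<theta> bp bm \<longleftrightarrow> finite \<theta> \<and>
     (\<forall>a \<in> \<theta>. \<forall>r \<in> \<theta>. \<forall>c \<in> \<theta>.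
        bp a c = bp c a \<and> bm a c = bm c a \<and> bp a c * bm a c = 1 \<and>
        (\<Sum>z\<in>\<theta>. bm a z * bp z c) = of_nat (card \<theta>) * (if a = c then 1 else 0) \<and>
        (\<Sum>z\<in>\<theta>. bp a z * bp r z * bm c z) =
          csqrt (of_nat (card \<theta>)) * bp a r * bm r c * bm c a)"

record weights =
  pos_eq :: complex
  neg_eq :: complex
  pos_ne :: complex
  neg_ne :: complex

definition potts_model :: "'s set \<Rightarrow> weights \<Rightarrow> bool" where
  "potts_model \<theta> b \<longleftrightarrow> card \<theta> \<ge> 3 \<and>
     spin_model \<theta> (\<lambda>a c. if a = c then pos_eq b else pos_ne b)
                  (\<lambda>a c. if a = c then neg_eq b else neg_ne b)"

definition sign_swap :: "weights \<Rightarrow> weights" where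
  "sign_swap b = \<lparr> pos_eq = neg_eq b, neg_eq = pos_eq b, pos_ne = neg_ne b, neg_ne = pos_ne b \<rparr>"

definition states :: "'s set \<Rightarrow> ('v, 'e) signed_graph \<Rightarrow> ('v \<Rightarrow> 's) set" where
  "states \<theta> G = verts G \<rightarrow>\<^sub>E \<theta>"

definition edge_weight :: "weights \<Rightarrow> ('v, 'e) signed_graph \<Rightarrow> ('v \<Rightarrow> 's) \<Rightarrow> 'e \<Rightarrow> complex" where
  "edge_weight b G \<sigma> e =
     (if \<forall>u \<in> ends G e. \<forall>v \<in> ends G e. \<sigma> u = \<sigma> v
      then (if positive G e then pos_eq b else neg_eq b)
      else (if positive G e then pos_ne b else neg_ne b))"

definition state_sum :: "'s set \<Rightarrow> weights \<Rightarrow> ('v, 'e) signed_graph \<Rightarrow> complex" where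
  "state_sum \<theta> b G = (\<Sum>\<sigma> \<in> states \<theta> G. \<Prod>e \<in> edges G. edge_weight b G \<sigma> e)"

definition partition_function :: "'s set \<Rightarrow> weights \<Rightarrow> ('v, 'e) signed_graph \<Rightarrow> complex" where
  "partition_function \<theta> b G =
     (1 / csqrt (of_nat (card \<theta>))) ^ (card (verts G) + 1) * state_sum \<theta> b G"

text \<open>\<open>P\<close> is the invariant of oriented links that Jones's theorem attaches to the Potts model \<open>b\<close>:
  its value on a link can be computed from any connected diagram of the link and any Tait graph of
  that diagram. The weights matter: for \<open>n = 3\<close> and for \<open>n \<ge> 5\<close> there are Potts models with the same
  \<open>n\<close> whose invariants differ, for instance \<open>b\<close> and \<open>sign_swap b\<close>.\<close>

definition potts_invariant :: "'s set \<Rightarrow> weights \<Rightarrow> (link \<Rightarrow> complex) \<Rightarrow> bool" where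
  "potts_invariant \<theta> b P \<longleftrightarrow>
     (\<forall>K D C. diagram_of D K \<and> checkerboard D C \<longrightarrow>
        P K = neg_eq b powi writhe D * partition_function \<theta> b (tait_graph D C))"

end

(* Put N for the cardinality of the spin set and t for y / x. The Potts ansatz reduces the axioms of
   a spin model to t + 1/t = 2 - N and x^2 (t - t^2) = sqrt N. Both equations are invariant under
   inverting x and t together, which is why the weights with the signs exchanged again form a Potts
   model. Taking the factor x or 1/x out of every edge weight turns b into B. *)

theory Submission
  imports Defs
begin

text \<open>In the sums of the spin model axioms the summand is constant once \<open>z\<close>
  differs from the at most three named spins. Subtracting in the ring allows
  \<open>of_nat (card A)\<close> to be replaced by an expression in \<open>t\<close>.\<close>

lemma sum_constant_outside:
  fixes f :: "'a \<Rightarrow> 'b::ring_1"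
  assumes "finite A" "S \<subseteq> A" "\<And>z. z \<in> A - S \<Longrightarrow> f z = k"
  shows "sum f A = sum f S + (of_nat (card A) - of_nat (card S)) * k"
proof -
  have "sum f A = sum f S + sum f (A - S)"
    using assms(1,2) by (metis sum.subset_diff add.commute)
  also have "sum f (A - S) = of_nat (card (A - S)) * k"
    using assms(3) by simp
  also have "card (A - S) = card A - card S"
    using assms(1,2) by (meson card_Diff_subset finite_subset)
  finally show ?thesis
    using assms(1,2) by (simp add: of_nat_diff card_mono)
qed

lemma potts_model_of_ratio:
  fixes x t :: complex
  assumes fin: "finite \<theta>" and card: "card \<theta> \<ge> 3"
    and nz: "x \<noteq> 0" "t \<noteq> 0"
    and N: "of_nat (card \<theta>) = 2 - t - inverse t"
    and root: "csqrt (of_nat (card \<theta>)) = x\<^sup>2 * (t - t\<^sup>2)"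
  shows "potts_model \<theta> \<lparr> pos_eq = x, neg_eq = inverse x,
           pos_ne = x * t, neg_ne = inverse (x * t) \<rparr>"
proof -
  \<comment> \<open>Naming the inverses turns all the axioms into polynomial identities modulo
    \<open>x * j = 1\<close> and \<open>t * k = 1\<close>.\<close>
  define j k where "j = inverse x" and "k = inverse t"
  have jk: "x * j = 1" "t * k = 1"
    using nz by (simp_all add: j_def k_def)
  then have cancel: "j * x = 1" "j * k * (x * t) = 1" "x * t * (j * k) = 1"
    by algebra+
  have N': "of_nat (card \<theta>) = 2 - t - k"
    using N by (simp add: k_def)
  define p where "p = (\<lambda>a c::'a. if a = c then x else x * t)"
  define m where "m = (\<lambda>a c::'a. if a = c then j else j * k)"
  have orth: "(\<Sum>z\<in>\<theta>. m a z * p z c) = of_nat (card \<theta>) * (if a = c then 1 else 0)"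
    if "a \<in> \<theta>" "c \<in> \<theta>" for a c
  proof -
    have "(\<Sum>z\<in>\<theta>. m a z * p z c) = (\<Sum>z\<in>{a, c}. m a z * p z c)
            + (of_nat (card \<theta>) - of_nat (card {a, c})) * 1"
      using fin that by (intro sum_constant_outside) (auto simp: p_def m_def cancel)
    then have eq: "(\<Sum>z\<in>\<theta>. m a z * p z c) = (\<Sum>z\<in>{a, c}. m a z * p z c)
            + (2 - t - k - of_nat (card {a, c}))"
      unfolding N' by simp
    show ?thesis
    proof (cases "a = c")
      case True
      then show ?thesis
        unfolding eq N' by (simp add: p_def m_def cancel)
    next
      case False
      \<comment> \<open>The two special spins contribute \<open>t\<close> and \<open>k\<close>, so
        the sum vanishes exactly because N = 2 - t - 1/t.\<close>
      show ?thesis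
        unfolding eq by (simp add: p_def m_def False False[symmetric]) (use jk in algebra)
    qed
  qed
  \<comment> \<open>The square root is replaced by its value from \<open>root\<close>. With all
    three spins equal, the axiom is precisely that equation; the other cases then hold too.\<close>
  have star: "(\<Sum>z\<in>\<theta>. p a z * p r z * m c z) = x\<^sup>2 * (t - t\<^sup>2) * p a r * m r c * m c a"
    if "a \<in> \<theta>" "r \<in> \<theta>" "c \<in> \<theta>" for a r c
  proof -
    have "(\<Sum>z\<in>\<theta>. p a z * p r z * m c z) = (\<Sum>z\<in>{a, r, c}. p a z * p r z * m c z)
            + (of_nat (card \<theta>) - of_nat (card {a, r, c})) * (x * t)"
      using fin that by (intro sum_constant_outside) (auto simp: p_def m_def cancel)
    then have eq: "(\<Sum>z\<in>\<theta>. p a z * p r z * m c z) = (\<Sum>z\<in>{a, r, c}. p a z * p r z * m c z)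
            + (2 - t - k - of_nat (card {a, r, c})) * (x * t)"
      unfolding N' .
    \<comment> \<open>The pattern of coincidences fixes \<open>card {a, r, c}\<close>, hence the
      number of remaining spins, each contributing \<open>x * t\<close>.\<close>
    consider "a = r" "r = c" | "a = r" "r \<noteq> c" | "a \<noteq> r" "r = c" | "a \<noteq> r" "a = c"
      | "a \<noteq> r" "r \<noteq> c" "a \<noteq> c"
      by blast
    then show ?thesis
    proof cases
      case 1
      show ?thesis
        unfolding eq by (simp add: p_def m_def 1) (use jk in algebra)
    next
      case 2
      show ?thesis
        unfolding eq by (simp add: p_def m_def 2 2(2)[symmetric]) (use jk in algebra)
    next
      case 3
      show ?thesis
        unfolding eq by (simp add: p_def m_def 3(2)[symmetric] 3(1) 3(1)[symmetric])
          (use jk in algebra)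
    next
      case 4
      show ?thesis
        unfolding eq by (simp add: p_def m_def 4(2)[symmetric] 4(1) 4(1)[symmetric] insert_commute)
          (use jk in algebra)
    next
      case 5
      show ?thesis
        unfolding eq by (simp add: p_def m_def 5 5[symmetric]) (use jk in algebra)
    qed
  qed
  have "p a c = p c a \<and> m a c = m c a \<and> p a c * m a c = 1" for a c
    by (auto simp: p_def m_def jk cancel)
  then have "spin_model \<theta> p m"
    unfolding spin_model_def root using fin orth star by blast
  then show ?thesis
    using card by (simp add: potts_model_def p_def m_def j_def k_def cong del: if_weak_cong)
qed

text \<open>\<open>t\<close> is a root of t^2 - (2 - N) t + 1, which gives the equation for N; the
  second equation comes from x^2 = 2 / W, where W is the base of the power in
  \<open>x\<close>.\<close>

lemma potts_weight_equations:
  fixes n :: nat and x t :: complex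
  assumes n: "n \<ge> 3"
    and x: "x = csqrt 2 * (csqrt (of_nat n) * (3 - of_nat n)
                  + (of_nat n - 1) * csqrt (of_nat n - 4)) powr (- 1 / 2)"
    and t: "t = 1 / 2 * (2 - of_nat n + csqrt (of_nat n * (of_nat n - 4)))"
  shows "x \<noteq> 0" "t \<noteq> 0" "of_nat n = 2 - t - inverse t"
    "csqrt (of_nat n) = x\<^sup>2 * (t - t\<^sup>2)"
proof -
  define N s q where "N = (of_nat n :: complex)" and "s = csqrt N" and "q = csqrt (N - 4)"
  define W where "W = s * (3 - N) + (N - 1) * q"
  have sq: "s\<^sup>2 = N" "q\<^sup>2 = N - 4"
    by (simp_all add: s_def q_def)
  \<comment> \<open>Principal square roots do not multiply in general; here one factor is a
    nonnegative real and the other is real, possibly negative as for n = 3.\<close>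
  have "csqrt (N * (N - 4)) = s * q"
  proof -
    have neg: "- (real n * (real n - 4)) = real n * (4 - real n)"
      by (simp add: algebra_simps)
    have "csqrt (of_real (real n) * of_real (real n - 4))
            = csqrt (of_real (real n)) * csqrt (of_real (real n - 4))"
      by (simp only: of_real_mult[symmetric])
        (cases "n \<ge> 4"; simp add: csqrt_of_real_nonneg csqrt_of_real_nonpos real_sqrt_mult
           mult_nonneg_nonpos neg flip: of_real_mult)
    then show ?thesis by (simp add: N_def s_def q_def)
  qed
  then have t2: "2 * t = 2 - N + s * q"
    unfolding t N_def by simp
  have quad: "t * t = (2 - N) * t - 1"
  proof -
    have "(2 * t - (2 - N))\<^sup>2 = s\<^sup>2 * q\<^sup>2"
      unfolding t2 by (simp add: power_mult_distrib)
    then show ?thesis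
      unfolding sq by (simp add: power2_eq_square algebra_simps) algebra
  qed
  then show t0: "t \<noteq> 0" by auto
  then show N_t: "of_nat n = 2 - t - inverse t"
    using quad by (simp add: N_def field_simps)
  \<comment> \<open>The quadratic gives t - t^2 = (N - 1) t + 1; inserting \<open>t2\<close> and
    writing N as s^2 exposes the factor \<open>s\<close>.\<close>
  have W_t: "2 * (t - t\<^sup>2) = s * W"
    using t2 quad sq unfolding W_def power2_eq_square by algebra
  have "N \<noteq> 0" using n by (simp add: N_def)
  \<comment> \<open>For t = 1 the equation would give N = 0. So t - t^2 is nonzero, which excludes W
    = 0, where \<open>powr\<close> would return 0.\<close>
  then have "t \<noteq> 1" using N_t by (auto simp: N_def)
  then have W0: "W \<noteq> 0"
    using W_t t0 by (auto simp: power2_eq_square)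
  have "(W powr (- 1 / 2))\<^sup>2 = inverse W"
    unfolding power2_eq_square powr_add[symmetric] using W0 by (simp add: powr_minus)
  moreover have "x = csqrt 2 * W powr (- 1 / 2)"
    unfolding x W_def s_def q_def N_def ..
  ultimately have x2: "x\<^sup>2 = 2 * inverse W"
    by (simp only: power_mult_distrib power2_csqrt)
  then show "x \<noteq> 0" using W0 by auto
  have "x\<^sup>2 * (t - t\<^sup>2) = inverse W * (2 * (t - t\<^sup>2))"
    unfolding x2 by simp
  then show "csqrt (of_nat n) = x\<^sup>2 * (t - t\<^sup>2)"
    unfolding W_t using W0 by (simp add: s_def N_def)
qed

text \<open>The product of x^2 (t - t^2) and its counterpart for the inverses is 2 - t - 1/t = N =
  s^2, so if the first factor is s and s is nonzero, the second is s as well. For t = 1 both sides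
  vanish.\<close>

lemma potts_equations_inverse:
  fixes N s x t :: complex
  assumes nz: "x \<noteq> 0" "t \<noteq> 0" and s: "s\<^sup>2 = N"
    and N: "N = 2 - t - inverse t" and root: "s = x\<^sup>2 * (t - t\<^sup>2)"
  shows "s = (inverse x)\<^sup>2 * (inverse t - (inverse t)\<^sup>2)"
proof (cases "t = 1")
  case True
  then show ?thesis using root by simp
next
  case False
  have "s * (x\<^sup>2 * (t - t\<^sup>2)) = 2 - t - inverse t"
    using s unfolding N root[symmetric] by (simp only: power2_eq_square)
  then have "(s * x\<^sup>2 * t\<^sup>2) * (1 - t) = (t - 1) * (1 - t)"
    using nz by (simp add: field_simps power2_eq_square)
  then have "s * x\<^sup>2 * t\<^sup>2 = t - 1"
    using False by simp
  then show ?thesis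
    using nz by (simp add: field_simps power2_eq_square)
qed

text \<open>The extracted factor depends only on the sign of an edge, so it is the same for every
  state and leaves the sum.\<close>

lemma state_sum_rescale:
  fixes x :: complex and \<theta> :: "'s set" and G :: "('v, 'e) signed_graph"
  assumes fin: "finite (edges G)" and x: "x \<noteq> 0"
    and w: "w = \<lparr> pos_eq = x * pos_eq w', neg_eq = inverse x * neg_eq w',
                  pos_ne = x * pos_ne w', neg_ne = inverse x * neg_ne w' \<rparr>"
  shows "state_sum \<theta> w G = x powi (int (num_pos G) - int (num_neg G)) * state_sum \<theta> w' G"
proof -
  have "(\<Prod>e\<in>edges G. edge_weight w G \<sigma> e) =
      x powi (int (num_pos G) - int (num_neg G)) * (\<Prod>e\<in>edges G. edge_weight w' G \<sigma> e)"
    for \<sigma> :: "'v \<Rightarrow> 's"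
  proof -
    have "edge_weight w G \<sigma> e = (if positive G e then x else inverse x) * edge_weight w' G \<sigma> e" for e
    proof -
      \<comment> \<open>Named so that the simplifier does not use the condition as a looping rewrite rule.\<close>
      define monochromatic where "monochromatic \<longleftrightarrow> (\<forall>u \<in> ends G e. \<forall>v \<in> ends G e. \<sigma> u = \<sigma> v)"
      show ?thesis
        unfolding edge_weight_def monochromatic_def[symmetric] w by simp
    qed
    moreover have "(\<Prod>e\<in>edges G. if positive G e then x else inverse x)
        = x ^ num_pos G * inverse x ^ num_neg G"
      using fin by (simp add: prod.If_cases num_pos_def num_neg_def Collect_conj_eq Collect_neg_eq)
    ultimately show ?thesis
      using x by (simp add: prod.distrib power_int_diff divide_inverse power_inverse)
  qed
  then show ?thesis by (simp add: state_sum_def sum_distrib_left)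
qed

text \<open>With the normalisation \<open>neg_eq w powi writhe D\<close>, the formula with
  \<open>b\<close> and exponent \<open>- writhe D\<close> evaluates the invariant of
  \<open>b\<close>, whereas the one with \<open>B\<close> evaluates that of
  \<open>sign_swap b\<close>. Hence both models appear, each with its plain and its rescaled
  formula.\<close>

theorem theorem1p1:
  fixes n :: nat and \<theta> :: "'s set" and K :: link and D :: diagram and C :: "complex set set"
    and G :: "(complex set, strand_point \<times> strand_point) signed_graph"
    and x y t :: complex and b B :: weights and Potts :: "weights \<Rightarrow> link \<Rightarrow> complex"
  assumes n: "n \<ge> 3"
    and spins: "finite \<theta>" "card \<theta> = n"
    and D: "diagram_of D K"
    and G: "checkerboard D C" "G = tait_graph D C"
    and x: "x = csqrt 2 * (csqrt (of_nat n) * (3 - of_nat n)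
                  + (of_nat n - 1) * csqrt (of_nat n - 4)) powr (- 1 / 2)"
    and y: "y = x / 2 * (2 - of_nat n + csqrt (of_nat n * (of_nat n - 4)))"
    and t: "t = y / x"
    and b: "b = \<lparr> pos_eq = x, neg_eq = inverse x, pos_ne = y, neg_ne = inverse y \<rparr>"
    and B: "B = \<lparr> pos_eq = 1, neg_eq = 1, pos_ne = inverse t, neg_ne = t \<rparr>"
    and Potts: "\<And>w. potts_model \<theta> w \<Longrightarrow> potts_invariant \<theta> w (Potts w)"
  shows "t = 1 / 2 * (2 - of_nat n + csqrt (of_nat n * (of_nat n - 4)))
    \<and> potts_model \<theta> b \<and> potts_model \<theta> (sign_swap b)
    \<and> Potts (sign_swap b) K =
        (1 / csqrt (of_nat n)) ^ (card (verts G) + 1)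
          * x powi (writhe D + int (num_neg G) - int (num_pos G))
          * (\<Sum>\<sigma> \<in> states \<theta> G. \<Prod>e \<in> edges G. edge_weight B G \<sigma> e)
    \<and> Potts b K =
        (1 / csqrt (of_nat n)) ^ (card (verts G) + 1)
          * x powi (- writhe D)
          * (\<Sum>\<sigma> \<in> states \<theta> G. \<Prod>e \<in> edges G. edge_weight b G \<sigma> e)
    \<and> Potts (sign_swap b) K =
        (1 / csqrt (of_nat n)) ^ (card (verts G) + 1)
          * x powi writhe D
          * (\<Sum>\<sigma> \<in> states \<theta> G. \<Prod>e \<in> edges G. edge_weight (sign_swap b) G \<sigma> e)
    \<and> Potts b K =
        (1 / csqrt (of_nat n)) ^ (card (verts G) + 1)
          * x powi (- writhe D + int (num_pos G) - int (num_neg G))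
          * (\<Sum>\<sigma> \<in> states \<theta> G. \<Prod>e \<in> edges G. edge_weight (sign_swap B) G \<sigma> e)"
proof -
  \<comment> \<open>The closed form \<open>u\<close> is kept apart from \<open>t = y / x\<close>
    until \<open>x\<close> is known to be nonzero.\<close>
  define u s where "u = 1 / 2 * (2 - of_nat n + csqrt (of_nat n * (of_nat n - 4)) :: complex)"
    and "s = csqrt (of_nat n)"
  have x0: "x \<noteq> 0" and u0: "u \<noteq> 0" and N: "of_nat n = 2 - u - inverse u"
    and root: "s = x\<^sup>2 * (u - u\<^sup>2)"
    using potts_weight_equations[OF n x u_def] by (simp_all add: s_def)
  have y_u: "y = x * u" by (simp add: y u_def)
  then have t_u: "t = u" using x0 by (simp add: t)
  have model: "potts_model \<theta> b"
    using potts_model_of_ratio[of \<theta> x u] spins n x0 u0 N root by (simp add: b y_u s_def)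
  have "s = (inverse x)\<^sup>2 * (inverse u - (inverse u)\<^sup>2)"
    using potts_equations_inverse[OF x0 u0 _ N root] by (metis s_def power2_csqrt)
  moreover have swap_b: "sign_swap b = \<lparr> pos_eq = inverse x, neg_eq = x,
      pos_ne = inverse y, neg_ne = y \<rparr>"
    by (simp add: sign_swap_def b)
  \<comment> \<open>Exchanging the signs inverts \<open>x\<close> and \<open>u\<close>, and N = 2 -
    u - 1/u is symmetric under this.\<close>
  ultimately have model_swap: "potts_model \<theta> (sign_swap b)"
    using potts_model_of_ratio[of \<theta> "inverse x" "inverse u"] spins n x0 u0 N
    by (simp add: y_u s_def)
  have fin: "finite (edges G)"
    using D by (simp add: G(2) tait_graph_def diagram_of_def connected_diagram_def link_diagram_def)
  have inv: "Potts w K = neg_eq w powi writhe D * partition_function \<theta> w G"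
    if "potts_model \<theta> w" for w
    using Potts[OF that] D G by (auto simp: potts_invariant_def)
  \<comment> \<open>Dividing the positive weights \<open>x\<close> and \<open>x * t\<close> of
    \<open>b\<close> by \<open>x\<close> leaves 1 and \<open>t\<close>, which are the negative
    weights of \<open>B\<close>; hence \<open>sign_swap B\<close> here and \<open>B\<close> for the
    swapped model.\<close>
  have sum_b: "state_sum \<theta> b G
      = x powi (int (num_pos G) - int (num_neg G)) * state_sum \<theta> (sign_swap B) G"
    by (rule state_sum_rescale[OF fin x0]) (simp add: b B sign_swap_def t_u y_u)
  have sum_swap: "state_sum \<theta> (sign_swap b) G
      = inverse x powi (int (num_pos G) - int (num_neg G)) * state_sum \<theta> B G"
    by (rule state_sum_rescale[OF fin])
      (use x0 in \<open>simp_all add: swap_b B t_u y_u\<close>)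
  have exp_swap: "inverse x powi (int (num_pos G) - int (num_neg G))
      = x powi (int (num_neg G) - int (num_pos G))"
    by (metis minus_diff_eq power_int_minus power_int_inverse)
  have main: "Potts b K = (1 / csqrt (of_nat n)) ^ (card (verts G) + 1)
      * x powi (- writhe D) * state_sum \<theta> b G"
    using inv[OF model] spins(2)
    by (simp add: b partition_function_def power_int_minus power_int_inverse del: power_Suc)
  have main_swap: "Potts (sign_swap b) K = (1 / csqrt (of_nat n)) ^ (card (verts G) + 1)
      * x powi writhe D * state_sum \<theta> (sign_swap b) G"
    using inv[OF model_swap] spins(2)
    by (simp add: swap_b partition_function_def del: power_Suc)
  have powi_add: "x powi (i + j) = x powi i * x powi j" for i j
    using x0 by (simp add: power_int_add)
  have norm: "Potts b K = (1 / csqrt (of_nat n)) ^ (card (verts G) + 1)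
      * x powi (- writhe D + int (num_pos G) - int (num_neg G)) * state_sum \<theta> (sign_swap B) G"
    unfolding main sum_b add_diff_eq[symmetric] by (simp only: powi_add mult.assoc)
  have norm_swap: "Potts (sign_swap b) K = (1 / csqrt (of_nat n)) ^ (card (verts G) + 1)
      * x powi (writhe D + int (num_neg G) - int (num_pos G)) * state_sum \<theta> B G"
    unfolding main_swap sum_swap exp_swap add_diff_eq[symmetric]
    by (simp only: powi_add mult.assoc)
  show ?thesis
    using t_u model model_swap norm norm_swap main main_swap
    unfolding u_def state_sum_def by blast
qed

end
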